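(* For $m \in \mathbb{N}$ and $Q > 1$, let $\mathrm{Sal}_m^{sq}(Q)$ be the set of Salem numbers of degree $2m$ that are square-rootable over $\mathbb{Q}$ and lie in the interval $(1, Q]$. Then for fixed $m \in \mathbb{N}$ and $Q \to \infty$, $$\# \mathrm{Sal}_m^{sq}(Q) = O\big(Q^{m/2} \cdot \eta(Q, m)\big),$$ where $$\eta(Q, m) = \begin{cases} Q^{1/2}, & \text{if } m = 1, 2; \\ \log(Q), & \text{if } m = 3, 4; \\ 1, & \text{if } m \ge 5, \end{cases}$$ and the implicit constant may depend on $m$.
   Context: A Salem number is a real algebraic integer $\lambda > 1$ that is conjugate (over $\mathbb{Q}$) to $\lambda^{-1}$ and all of whose remaining conjugates lie on the unit circle; Salem numbers of degree $2$ are allowed. A polynomial $p$ is palindromic if $p(x) = x^{\deg p} p(x^{-1})$. A Salem number $\lambda$ is square-rootable over $\mathbb{Q}$ if there exist a positive $\alpha \in \mathbb{Q}$ and a monic palindromic polynomial $q$ whose even degree coefficients lie in $\mathbb{Q}$ and whose odd degree coefficients lie in $\sqrt{\alpha}\,\mathbb{Q}$, such that $q(x) q(-x) = p(x^2)$, where $p$ is the minimal polynomial of $\lambda$ over $\mathbb{Q}$. $\log$ is the natural logarithm and $\#X$ is the cardinality of $X$. *)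

theory Defs
  imports
    "HOL-Computational_Algebra.Polynomial"
    "HOL-Library.Landau_Symbols"
begin

definition is_min_poly :: "real \<Rightarrow> rat poly \<Rightarrow> bool" where
  "is_min_poly x p \<longleftrightarrow>
     lead_coeff p = 1 \<and> poly (map_poly of_rat p) x = 0 \<and>
     (\<forall>r. r \<noteq> 0 \<and> poly (map_poly of_rat r) x = 0 \<longrightarrow> degree p \<le> degree r)"

text \<open>Unspecified for transcendental arguments; see \<open>is_min_poly_min_poly\<close> for the algebraic ones.\<close>

definition min_poly :: "real \<Rightarrow> rat poly" where
  "min_poly x = (THE p. is_min_poly x p)"

lemma is_min_poly_unique:
  assumes p: "is_min_poly x p" and r: "is_min_poly x r"
  shows "p = r"
proof (rule ccontr)
  assume "p \<noteq> r"
  define d where "d = p - r"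
  have d0: "d \<noteq> 0" using \<open>p \<noteq> r\<close> by (simp add: d_def)
  have ne: "p \<noteq> 0" "r \<noteq> 0" using p r by (auto simp: is_min_poly_def)
  have deg: "degree p = degree r"
    using p r ne by (metis is_min_poly_def order_antisym)
  have "map_poly of_rat d = map_poly of_rat p - (map_poly of_rat r :: real poly)"
    by (intro poly_eqI) (simp add: d_def coeff_map_poly of_rat_diff)
  hence "poly (map_poly of_rat d) x = 0"
    using p r by (simp add: is_min_poly_def)
  hence le: "degree p \<le> degree d" using p d0 by (simp add: is_min_poly_def)
  have "degree d \<le> degree p" using deg degree_diff_le[of p "degree p" r] by (simp add: d_def)
  with le have eq: "degree d = degree p" by simp
  have "coeff d (degree p) = 0"
    using p r deg by (simp add: d_def is_min_poly_def)
  thus False using d0 eq by (metis leading_coeff_0_iff)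
qed

lemma is_min_poly_min_poly:
  assumes "algebraic x"
  shows "is_min_poly x (min_poly x)"
proof -
  let ?P = "\<lambda>r::rat poly. r \<noteq> 0 \<and> poly (map_poly of_rat r) x = 0"
  obtain p :: "real poly" where p: "\<And>i. coeff p i \<in> \<int>" "p \<noteq> 0" "poly p x = 0"
    using assms unfolding algebraic_def by blast
  define r where "r = map_poly (\<lambda>c::real. of_int \<lfloor>c\<rfloor> :: rat) p"
  have rp: "map_poly of_rat r = p"
    by (intro poly_eqI) (use p(1) in \<open>auto simp: r_def coeff_map_poly elim!: Ints_cases\<close>)
  have "?P r" using p rp by auto
  then obtain s where s: "?P s" "\<And>t. ?P t \<Longrightarrow> degree s \<le> degree t"
    using ex_has_least_nat[of ?P r degree] by auto
  define u where "u = smult (inverse (lead_coeff s)) s"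
  have "map_poly of_rat u = smult (of_rat (inverse (lead_coeff s))) (map_poly of_rat s :: real poly)"
    by (intro poly_eqI) (simp add: u_def coeff_map_poly of_rat_mult)
  hence "is_min_poly x u"
    using s unfolding is_min_poly_def by (auto simp: u_def)
  thus ?thesis unfolding min_poly_def
    by (rule theI) (use \<open>is_min_poly x u\<close> is_min_poly_unique in blast)
qed

definition rat_conjugates :: "real \<Rightarrow> complex set" where
  "rat_conjugates x = {z. poly (map_poly of_rat (min_poly x)) z = 0}"

text \<open>The set of remaining conjugates may be empty, so degree 2 is allowed.\<close>

definition salem_number :: "real \<Rightarrow> bool" where
  "salem_number l \<longleftrightarrow>
     algebraic_int l \<and> l > 1 \<and>
     complex_of_real (inverse l) \<in> rat_conjugates l \<and>
     (\<forall>z \<in> rat_conjugates l - {complex_of_real l, complex_of_real (inverse l)}. cmod z = 1)"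

text \<open>\<open>reflect_poly p\<close> is the polynomial $x^{\deg p} p(x^{-1})$; cf. \<open>poly_reflect_poly_nz\<close>.\<close>

definition palindromic :: "'a::zero poly \<Rightarrow> bool" where
  "palindromic p \<longleftrightarrow> p = reflect_poly p"

text \<open>The compositions with \<open>[:0, -1:]\<close> and \<open>[:0, 0, 1:]\<close> are $q(-x)$ and $p(x^2)$.\<close>

definition square_rootable :: "real \<Rightarrow> bool" where
  "square_rootable l \<longleftrightarrow>
     (\<exists>(a::rat) (q::real poly).
        a > 0 \<and> lead_coeff q = 1 \<and> palindromic q \<and>
        (\<forall>i. even i \<longrightarrow> coeff q i \<in> \<rat>) \<and>
        (\<forall>i. odd i \<longrightarrow> (\<exists>r\<in>\<rat>. coeff q i = sqrt (of_rat a) * r)) \<and>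
        q * pcompose q [:0, -1:] = pcompose (map_poly of_rat (min_poly l)) [:0, 0, 1:])"

definition Sal_sq :: "nat \<Rightarrow> real \<Rightarrow> real set" where
  "Sal_sq m Q =
     {l. salem_number l \<and> degree (min_poly l) = 2 * m \<and> square_rootable l \<and> 1 < l \<and> l \<le> Q}"

text \<open>Only meaningful for \<open>m \<ge> 1\<close>.\<close>

definition eta :: "real \<Rightarrow> nat \<Rightarrow> real" where
  "eta Q m =
     (if m = 1 \<or> m = 2 then Q powr (1/2)
      else if m = 3 \<or> m = 4 then ln Q
      else 1)"

end

theory Submission
  imports
    Defs
    "HOL-Computational_Algebra.Fundamental_Theorem_Algebra"
    "HOL-Computational_Algebra.Squarefree"
    "HOL-Library.FuncSet"
begin

text \<open>
  The proof counts the square root polynomials \<open>q\<close> instead of the Salem numbers. Let \<open>\<lambda> \<le> Q\<close> be a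
  square-rootable Salem number of degree \<open>2m\<close> with minimal polynomial \<open>p\<close>, and \<open>q(x) q(-x) = p(x\<^sup>2)\<close>.

  Size: one root of \<open>q\<close> is \<open>\<plusminus>\<surd>\<lambda>\<close> and the others lie in the closed unit disc, so every coefficient of
  \<open>q\<close> is at most \<open>B = 4\<^sup>m \<surd>Q\<close> in absolute value (\<open>square_root_poly_coeff_bound\<close>).

  Arithmetic: \<open>p\<close> has integer coefficients, and a variant of Gauss's lemma shows that the squares of
  the coefficients of \<open>q\<close> are integers (\<open>coeff_square_integral\<close>). Hence the coefficients of even
  degree are integers. Writing \<open>\<surd>\<alpha>\<close> as a rational multiple of \<open>\<surd>n\<close> with \<open>n\<close> squarefree, those of odd
  degree are integer multiples of \<open>\<surd>n\<close>, and \<open>n \<le> B\<^sup>2\<close> can be assumed (\<open>Sal_sq_parametrized\<close>).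

  Counting: a monic palindromic \<open>q\<close> is given by its coefficients of degree \<open>1, \<dots>, m\<close>, of which
  \<open>k = \<lceil>m / 2\<rceil>\<close> have odd degree. For given \<open>n \<le> B\<^sup>2\<close> each coefficient of even degree has at most
  \<open>3 B\<close> values and each one of odd degree at most \<open>3 B / \<surd>n\<close>, so the number of polynomials \<open>q\<close> is at
  most \<open>(3 B)\<^sup>m\<close> times the sum of \<open>n\<close> to the power \<open>-k / 2\<close> over \<open>1 \<le> n \<le> B\<^sup>2\<close> (\<open>card_Sal_sq_le\<close>).
  The first factor is of order \<open>Q\<close> to the power \<open>m / 2\<close>, and the sum is \<open>O(\<eta>(Q, m))\<close>
  (\<open>sum_le_eta\<close>).
\<close>

section \<open>Polynomials under ring homomorphisms\<close>

lemma map_poly_hom_mult: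
  fixes h :: "'a::comm_ring_1 \<Rightarrow> 'b::comm_ring_1"
  assumes "h 0 = 0" "\<And>a b. h (a + b) = h a + h b" "\<And>a b. h (a * b) = h a * h b"
  shows "map_poly h (f * g) = map_poly h f * map_poly h g"
proof -
  have sum: "h (sum u A) = (\<Sum>x\<in>A. h (u x))" for u :: "nat \<Rightarrow> 'a" and A
    by (induction A rule: infinite_finite_induct) (simp_all add: assms)
  show ?thesis
    by (intro poly_eqI) (simp add: coeff_map_poly coeff_mult sum assms)
qed

lemma poly_map_poly_of_real: 
  "poly (map_poly of_real f) (of_real x :: complex) = of_real (poly f x)"
  by (induction f) (simp_all add: map_poly_pCons)

lemma poly_map_poly_of_rat_real:
  "poly (map_poly of_real (map_poly of_rat f)) (z :: complex) = poly (map_poly of_rat f) z"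
proof -
  have "complex_of_real (of_rat r) = of_rat r" for r
    by (cases r) (simp add: of_rat_rat)
  thus ?thesis by (simp add: map_poly_map_poly o_def)
qed

section \<open>Integrality of the minimal polynomial\<close>

lemma rat_poly_eq_smult_primitive:
  fixes p :: "rat poly"
  assumes "p \<noteq> 0"
  obtains c :: rat and F :: "int poly" where "content F = 1" "p = smult c (map_poly of_int F)"
proof -
  have "\<exists>D>0. \<forall>i. of_int D * coeff p i \<in> \<int>"
  proof (induction p)
    case 0
    show ?case by (intro exI[of _ 1]) simp
  next
    case (pCons a p)
    then obtain D where D: "D > 0" "\<And>i. of_int D * coeff p i \<in> \<int>" by blast
    obtain x y where xy: "y > 0" "a = of_int x / of_int y"
      by (cases a) (auto simp: Fract_of_int_quotient)
    have a: "of_int (D * y) * a \<in> \<int>" 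
    proof -
      have "of_int (D * y) * a = of_int (D * x)" using xy by simp
      thus ?thesis by (metis Ints_of_int)
    qed
    have b: "of_int (D * y) * coeff p i \<in> \<int>" for i
      using D(2)[of i] Ints_mult[OF Ints_of_int[of y] D(2)[of i]] by (simp add: mult_ac)
    show ?case
      by (intro exI[of _ "D * y"]) (use D(1) xy(1) a b in \<open>auto simp: coeff_pCons split: nat.splits\<close>)
  qed
  then obtain D where D: "D > 0" "\<And>i. of_int D * coeff p i \<in> \<int>" by blast
  define G :: "int poly" where "G = map_poly floor (smult (of_int D) p)"
  have G: "map_poly of_int G = smult (of_int D) p"
    by (intro poly_eqI) (use D(2) in \<open>auto simp: G_def coeff_map_poly elim!: Ints_cases\<close>)
  have "G \<noteq> 0" using G assms D(1) by auto
  have "p = smult (1 / of_int D) (map_poly of_int G)"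
    using D(1) by (simp add: G)
  also have "map_poly of_int G = smult (of_int (content G)) (map_poly of_int (primitive_part G) :: rat poly)"
    by (subst content_times_primitive_part[of G, symmetric], intro poly_eqI)
       (simp add: coeff_map_poly del: content_times_primitive_part)
  finally have "p = smult (of_int (content G) / of_int D) (map_poly of_int (primitive_part G))"
    by simp
  moreover have "content (primitive_part G) = 1" using \<open>G \<noteq> 0\<close> by simp
  ultimately show thesis using that by blast
qed

text \<open>Gauss's lemma: monic rational factors of a monic integer polynomial are integral.\<close>

lemma monic_factor_integral:
  fixes p g :: "rat poly" and P :: "int poly"
  assumes "lead_coeff P = 1" "lead_coeff p = 1" and P: "map_poly of_int P = p * g"
  shows "coeff p i \<in> \<int>"
proof -
  have "P \<noteq> 0" "p \<noteq> 0" using assms by auto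
  have P0: "map_poly of_int P \<noteq> (0 :: rat poly)"
    using \<open>P \<noteq> 0\<close> by (metis coeff_0 coeff_map_poly leading_coeff_0_iff of_int_0 of_int_eq_0_iff)
  have "g \<noteq> 0" using P P0 by auto
  obtain c F where F: "content F = 1" "p = smult c (map_poly of_int F)"
    using rat_poly_eq_smult_primitive[OF \<open>p \<noteq> 0\<close>] by blast
  obtain d G where G: "content G = 1" "g = smult d (map_poly of_int G)"
    using rat_poly_eq_smult_primitive[OF \<open>g \<noteq> 0\<close>] by blast
  have "F \<noteq> 0" "G \<noteq> 0" using F G by auto
  have FG: "map_poly of_int P = smult (c * d) (map_poly of_int (F * G))"
    by (simp add: P F(2) G(2) map_poly_hom_mult mult_ac)
  have co: "of_int (coeff P j) = c * d * of_int (coeff (F * G) j)" for j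
    using arg_cong[OF FG, of "\<lambda>f. coeff f j"] by (simp add: coeff_map_poly)
  \<comment> \<open>Comparing leading coefficients shows that \<open>c d = 1 / k\<close>; comparing contents, that \<open>k\<close> is a unit.\<close>
  define k where "k = coeff (F * G) (degree P)"
  have k: "c * d * of_int k = 1" using co[of "degree P"] assms(1) by (simp add: k_def)
  have "of_int (coeff (smult k P) j) = (of_int (coeff (F * G) j) :: rat)" for j
    using co[of j] k by (simp add: algebra_simps)
  hence "smult k P = F * G" by (intro poly_eqI) (simp only: of_int_eq_iff)
  hence "content (smult k P) = content (F * G)" by simp
  also have "\<dots> = 1" using F G by (simp add: content_mult)
  finally have "\<bar>k\<bar> * content P = 1" by simp
  hence "\<bar>k\<bar> dvd 1" by (metis dvd_triv_left)
  hence "k dvd 1" by simp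
  have "lead_coeff F * lead_coeff G = lead_coeff (smult k P)"
    using \<open>smult k P = F * G\<close> by (simp add: lead_coeff_mult)
  also have "\<dots> = k" using assms(1) by simp
  finally have "lead_coeff F dvd 1" using \<open>k dvd 1\<close> by (metis dvd_trans dvd_triv_left)
  hence lF: "lead_coeff F = 1 \<or> lead_coeff F = -1" by auto
  have "c \<noteq> 0" using F(2) \<open>p \<noteq> 0\<close> by auto
  hence "c * of_int (lead_coeff F) = 1"
    using assms(2) F(2) by (simp add: coeff_map_poly degree_map_poly)
  hence "c = 1 \<or> c = -1" using lF by (auto simp: minus_equation_iff)
  hence "c \<in> \<int>" by auto
  thus ?thesis by (simp add: F(2) coeff_map_poly)
qed

text \<open>The minimal polynomial divides any rational polynomial vanishing at \<open>x\<close>, in particular a monic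
  integer one, so Gauss's lemma applies.\<close>

lemma coeff_min_poly_in_Ints:
  assumes "algebraic_int x"
  shows "coeff (min_poly x) i \<in> \<int>"
proof -
  obtain P :: "int poly" where P: "poly (map_poly of_int P) x = 0" "lead_coeff P = 1"
    using assms unfolding algebraic_int_altdef_ipoly by blast
  define p where "p = min_poly x"
  define R :: "rat poly" where "R = map_poly of_int P"
  have p: "lead_coeff p = 1" "poly (map_poly of_rat p) x = 0"
    and least: "\<And>r. r \<noteq> 0 \<Longrightarrow> poly (map_poly of_rat r) x = 0 \<Longrightarrow> degree p \<le> degree r"
    using is_min_poly_min_poly[of x] assms unfolding p_def is_min_poly_def by auto
  have "p \<noteq> 0" using p(1) by auto
  have R: "poly (map_poly of_rat R) x = 0"
    using P(1) by (simp add: R_def map_poly_map_poly o_def)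
  define r where "r = R mod p"
  have "map_poly of_rat r = map_poly of_rat R - (map_poly of_rat (p * (R div p)) :: real poly)"
    unfolding r_def by (subst minus_mult_div_eq_mod[symmetric])
      (intro poly_eqI, simp add: coeff_map_poly of_rat_diff)
  also have "map_poly of_rat (p * (R div p)) = map_poly of_rat p * (map_poly of_rat (R div p) :: real poly)"
    by (simp add: map_poly_hom_mult of_rat_add of_rat_mult)
  finally have "poly (map_poly of_rat r) x = 0" using R p(2) by simp
  hence "r = 0" using least[of r] degree_mod_less[OF \<open>p \<noteq> 0\<close>, of R] \<open>p \<noteq> 0\<close>
    unfolding r_def by (metis linorder_not_less)
  hence "map_poly of_int P = p * (R div p)"
    unfolding r_def R_def by (metis add.right_neutral mult_div_mod_eq)
  thus ?thesis using monic_factor_integral[OF P(2) p(1)] unfolding p_def by blast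
qed

section \<open>Integrality of the square root polynomial\<close>

text \<open>Write \<open>r\<close> as \<open>x / y\<close> in lowest terms: then \<open>y\<^sup>2\<close> divides \<open>n\<close>. The case \<open>n = 1\<close> says that a
  rational number with integral square is an integer.\<close>

lemma squarefree_mult_square_integral:
  fixes r :: real and n :: nat
  assumes "squarefree n" "r \<in> \<rat>" "of_nat n * r ^ 2 \<in> \<int>"
  shows "r \<in> \<int>"
proof -
  obtain x y where xy: "y > 0" "coprime x y" "r = of_int x / of_int y"
    using assms(2) by (rule Rats_cases')
  obtain k where "of_nat n * r ^ 2 = of_int k" using assms(3) by (auto elim: Ints_cases)
  hence "of_nat n * of_int x ^ 2 = (of_int k * of_int y ^ 2 :: real)"
    using xy by (simp add: field_simps)
  hence "(of_int (int n * x ^ 2) :: real) = of_int (k * y ^ 2)" by simp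
  hence "int n * x ^ 2 = k * y ^ 2" by (simp only: of_int_eq_iff)
  hence "y ^ 2 dvd int n * x ^ 2" by simp
  moreover have "coprime (y ^ 2) (x ^ 2)" using xy(2) by (simp add: coprime_commute)
  ultimately have "y ^ 2 dvd int n" by (simp add: coprime_dvd_mult_left_iff)
  hence "nat y ^ 2 dvd n" using xy(1)
    by (metis int_nat_eq of_nat_dvd_iff of_nat_power order_less_imp_le)
  hence "nat y dvd 1" using assms(1) by (simp add: squarefree_def)
  hence "y = 1" using xy(1) by simp
  thus ?thesis using xy(3) by simp
qed

lemma coeff_mult_reflected:
  fixes q :: "'a::comm_ring_1 poly"
  shows "coeff (q * pcompose q [:0, -1:]) k = (\<Sum>j\<le>k. (-1) ^ (k - j) * (coeff q j * coeff q (k - j)))"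
  by (simp add: coeff_mult coeff_pcompose_linear mult_ac)

text \<open>A version of Gauss's lemma for a polynomial whose coefficients are only square roots of
  rational numbers. The products of two coefficients whose indices have equal parity are rational,
  and these are the only ones that occur in an even coefficient of \<open>q(x) q(-x)\<close>.

  As in the classical proof, let \<open>D\<close> be the least common denominator of the squares \<open>a\<^sub>i\<^sup>2\<close> of the
  coefficients, let \<open>r\<close> be a prime divisor of \<open>D\<close>, and let \<open>i\<close> be least such that \<open>r\<close> does not divide
  \<open>D a\<^sub>i\<^sup>2\<close>. Up to sign, the coefficient of degree \<open>2i\<close> of \<open>D q(x) q(-x)\<close> is the sum of \<open>D a\<^sub>i\<^sup>2\<close> and
  of terms \<open>D a\<^sub>j a\<^sub>l\<close> with \<open>j < i\<close>. These are rational with square \<open>(D a\<^sub>j\<^sup>2)(D a\<^sub>l\<^sup>2)\<close>, an integer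
  divisible by \<open>r\<close>, so they are multiples of \<open>r\<close>. Hence so is \<open>D a\<^sub>i\<^sup>2\<close>, a contradiction.\<close>

lemma coeff_square_integral:
  fixes q :: "real poly"
  assumes rat: "\<And>i j. even (i + j) \<Longrightarrow> coeff q i * coeff q j \<in> \<rat>"
    and int: "\<And>i. coeff (q * pcompose q [:0, -1:]) (2 * i) \<in> \<int>"
  shows "coeff q i ^ 2 \<in> \<int>"
proof -
  define good where "good D \<longleftrightarrow> D > 0 \<and> (\<forall>i. of_nat D * coeff q i ^ 2 \<in> \<int>)" for D :: nat
  \<comment> \<open>A common denominator exists because almost all coefficients vanish.\<close>
  have "\<exists>D>0. \<forall>i<n. of_nat D * coeff q i ^ 2 \<in> \<int>" for n
  proof (induction n)
    case (Suc n)
    then obtain D :: nat where D: "D > 0" "\<And>i. i < n \<Longrightarrow> of_nat D * coeff q i ^ 2 \<in> \<int>" by blast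
    have "coeff q n ^ 2 \<in> \<rat>" using rat[of n n] by (simp add: power2_eq_square)
    then obtain x y where xy: "y > 0" "coprime x y" "coeff q n ^ 2 = of_int x / of_int y"
      by (rule Rats_cases')
    have 1: "of_nat (D * nat y) * coeff q n ^ 2 = of_int (int D * x)"
      using xy by simp
    have "of_nat (D * nat y) * coeff q i ^ 2 \<in> \<int>" if "i < Suc n" for i
    proof (cases "i = n")
      case True
      thus ?thesis using 1 by (metis Ints_of_int)
    next
      case False
      hence "of_nat D * coeff q i ^ 2 \<in> \<int>" using D(2)[of i] that by simp
      from Ints_mult[OF Ints_of_nat this]
      have "of_nat (nat y) * (of_nat D * coeff q i ^ 2) \<in> \<int>" .
      thus ?thesis by (simp only: of_nat_mult mult_ac)
    qed
    thus ?case using D(1) xy(1) by (intro exI[of _ "D * nat y"]) auto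
  qed auto
  from this[of "Suc (degree q)"] obtain D0
    where D0: "D0 > 0" "\<And>i. i < Suc (degree q) \<Longrightarrow> of_nat D0 * coeff q i ^ 2 \<in> \<int>" by blast
  have "good D0" unfolding good_def
  proof (intro conjI allI)
    show "of_nat D0 * coeff q i ^ 2 \<in> \<int>" for i
      using D0(2)[of i] by (cases "i \<le> degree q") (auto simp: coeff_eq_0)
  qed (use D0 in auto)
  define D where "D = (LEAST D. good D)"
  have D: "good D" unfolding D_def by (rule LeastI[of good, OF \<open>good D0\<close>])
  have least: "D \<le> E" if "good E" for E unfolding D_def by (rule Least_le[of good, OF that])
  have "D = 1"
  proof (rule ccontr)
    assume "D \<noteq> 1"
    then obtain r where r: "prime r" "r dvd D" using prime_factor_nat by blast
    then obtain E where E: "D = r * E" by blast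
    define bad where "bad i \<longleftrightarrow> of_nat D * coeff q i ^ 2 \<notin> range (\<lambda>k. of_int (int r * k))" for i
    have "\<not> good E" using least[of E] D E r(1) by (auto simp: good_def prime_nat_iff)
    moreover have "E > 0" using D E by (auto simp: good_def)
    ultimately obtain i0 where i0: "of_nat E * coeff q i0 ^ 2 \<notin> \<int>" by (auto simp: good_def)
    have "bad i0"
    proof (rule ccontr)
      assume "\<not> bad i0"
      then obtain k where "of_nat D * coeff q i0 ^ 2 = of_int (int r * k)" by (auto simp: bad_def)
      hence "of_nat E * coeff q i0 ^ 2 = of_int k" using r(1) E by (auto simp: prime_gt_0_nat)
      thus False using i0 by simp
    qed
    define i where "i = (LEAST i. bad i)"
    have i: "bad i" unfolding i_def by (rule LeastI[of bad, OF \<open>bad i0\<close>])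
    have ok: "\<not> bad j" if "j < i" for j using that not_less_Least unfolding i_def by blast
    \<comment> \<open>The multiples of \<open>r\<close>; they form an ideal of the integers.\<close>
    let ?M = "range (\<lambda>k. of_int (int r * k)) :: real set"
    have M_add: "x + y \<in> ?M" if xy: "x \<in> ?M" "y \<in> ?M" for x y
    proof -
      obtain k l where "x = of_int (int r * k)" "y = of_int (int r * l)" using xy by blast
      hence "x + y = of_int (int r * (k + l))" by (simp add: algebra_simps)
      thus ?thesis by blast
    qed
    have M_mult: "z * x \<in> ?M" if xz: "x \<in> ?M" "z \<in> \<int>" for x z
    proof -
      obtain k l where "x = of_int (int r * k)" "z = of_int l" using xz by (auto elim!: Ints_cases)
      hence "z * x = of_int (int r * (l * k))" by simp
      thus ?thesis by blast
    qed
    have M_sum: "sum u A \<in> ?M" if "\<And>a. a \<in> A \<Longrightarrow> u a \<in> ?M" for u :: "nat \<Rightarrow> real" and A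
      using that
    proof (induction A rule: infinite_finite_induct)
      case (insert a A)
      thus ?case using M_add by simp
    qed (auto intro!: image_eqI[of _ _ 0])
    have off: "of_nat D * (coeff q j * coeff q l) \<in> ?M" if jl: "j < i" "even (j + l)" for j l
    proof -
      define t where "t = of_nat D * (coeff q j * coeff q l)"
      have "t \<in> \<rat>" unfolding t_def using rat[OF jl(2)] by simp
      obtain k where k: "of_nat D * coeff q j ^ 2 = of_int (int r * k)"
        using ok[OF jl(1)] by (auto simp: bad_def)
      obtain k' where k': "of_nat D * coeff q l ^ 2 = of_int k'"
        using D by (auto simp: good_def elim: Ints_cases)
      have "t ^ 2 = (of_nat D * coeff q j ^ 2) * (of_nat D * coeff q l ^ 2)"
        by (simp add: t_def power2_eq_square mult_ac)
      hence t2: "t ^ 2 = of_int (int r * k * k')" using k k' by simp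
      hence "of_nat 1 * t ^ 2 \<in> \<int>" by (metis Ints_of_int mult_1 of_nat_1)
      hence "t \<in> \<int>"
        using squarefree_mult_square_integral[of 1 t] \<open>t \<in> \<rat>\<close> by simp
      then obtain s where s: "t = of_int s" by (auto elim: Ints_cases)
      have "(of_int (s ^ 2) :: real) = of_int (int r * k * k')" using t2 s by simp
      hence "s ^ 2 = int r * k * k'" by (simp only: of_int_eq_iff)
      hence "int r dvd s ^ 2" by simp
      hence "int r dvd s" using r(1) by (meson prime_dvd_power prime_nat_int_transfer)
      then obtain k where "s = int r * k" by blast
      thus ?thesis using s unfolding t_def by blast
    qed
    define u where "u j = (-1) ^ (2 * i - j) * (of_nat D * (coeff q j * coeff q (2 * i - j)))" for j
    have "(\<Sum>j\<le>2 * i. u j) = of_nat D * coeff (q * pcompose q [:0, -1:]) (2 * i)"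
      unfolding coeff_mult_reflected sum_distrib_left u_def by (intro sum.cong) (simp_all add: mult_ac)
    also have "\<dots> = coeff (q * pcompose q [:0, -1:]) (2 * i) * of_int (int r * int E)"
      by (simp add: E)
    also have "\<dots> \<in> ?M" by (rule M_mult[OF _ int]) blast
    finally have total: "(\<Sum>j\<le>2 * i. u j) \<in> ?M" .
    have "u j \<in> ?M" if "j \<in> {..2 * i} - {i}" for j
    proof -
      have "of_nat D * (coeff q j * coeff q (2 * i - j)) \<in> ?M"
      proof (cases "j < i")
        case True
        thus ?thesis by (intro off) auto
      next
        case False
        hence "of_nat D * (coeff q (2 * i - j) * coeff q j) \<in> ?M"
          using that by (intro off) auto
        thus ?thesis by (simp add: mult.commute)
      qed
      thus ?thesis unfolding u_def by (rule M_mult) auto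
    qed
    hence "(\<Sum>j\<in>{..2 * i} - {i}. u j) \<in> ?M" by (rule M_sum)
    hence "(\<Sum>j\<le>2 * i. u j) + (-1) * (\<Sum>j\<in>{..2 * i} - {i}. u j) \<in> ?M"
      by (intro M_add M_mult total) auto
    also have "(\<Sum>j\<le>2 * i. u j) + (-1) * (\<Sum>j\<in>{..2 * i} - {i}. u j) = u i"
      by (subst sum.remove[of _ i]) auto
    finally have "(-1) ^ i * u i \<in> ?M" by (rule M_mult) auto
    also have "(-1) ^ i * u i = of_nat D * coeff q i ^ 2"
      by (simp add: u_def power2_eq_square mult_2 flip: mult.assoc power_add)
    finally show False using i by (simp add: bad_def)
  qed
  thus ?thesis using D by (simp add: good_def)
qed

section \<open>Bounds for the coefficients\<close>

lemma norm_coeff_le_of_roots_in_unit_disc: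
  fixes f :: "complex poly"
  assumes "lead_coeff f = 1" "\<And>z. poly f z = 0 \<Longrightarrow> cmod z \<le> 1"
  shows "cmod (coeff f i) \<le> 2 ^ degree f"
  using assms
proof (induction "degree f" arbitrary: f i)
  case 0
  then obtain c where "f = [:c:]" using degree_eq_zeroE by metis
  thus ?case using 0 by (cases i) auto
next
  case (Suc n)
  have "\<not> constant (poly f)" using Suc.hyps(2) constant_degree[of f] by simp
  then obtain z where z: "poly f z = 0" using fundamental_theorem_of_algebra by blast
  then obtain g where g: "f = [:-z, 1:] * g" by (auto simp: poly_eq_0_iff_dvd elim: dvdE)
  have "f \<noteq> 0" using Suc.prems by auto
  hence "g \<noteq> 0" using g by auto
  have "degree f = 1 + degree g" unfolding g using \<open>g \<noteq> 0\<close> by (subst degree_mult_eq) auto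
  hence deg: "n = degree g" using Suc.hyps(2) by simp
  have "lead_coeff f = lead_coeff g" unfolding g by (subst lead_coeff_mult) simp
  hence IH: "cmod (coeff g j) \<le> 2 ^ n" for j
    unfolding deg using Suc.hyps(1)[OF deg, of j] Suc.prems(1) Suc.prems(2) by (auto simp: g deg)
  have "coeff f i = coeff (pCons 0 g) i - z * coeff g i" by (simp add: g)
  also have "cmod \<dots> \<le> cmod (coeff (pCons 0 g) i) + cmod z * cmod (coeff g i)"
    by (metis norm_mult norm_triangle_ineq4)
  also have "\<dots> \<le> 2 ^ n + 1 * 2 ^ n"
    using IH Suc.prems(2)[OF z] by (intro add_mono mult_mono) (auto simp: coeff_pCons split: nat.splits)
  finally show ?case by (simp flip: Suc.hyps(2))
qed

text \<open>A double root would also be a root of the derivative, which has smaller degree.\<close>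

lemma min_poly_simple_root:
  assumes "algebraic l" "degree (min_poly l) > 0"
    and s: "map_poly of_rat (min_poly l) = [:-l, 1:] * s"
  shows "poly s l \<noteq> 0"
proof
  assume "poly s l = 0"
  define p where "p = min_poly l"
  have p: "\<And>r. r \<noteq> 0 \<Longrightarrow> poly (map_poly of_rat r) l = 0 \<Longrightarrow> degree p \<le> degree r"
    using is_min_poly_min_poly[OF assms(1)] unfolding p_def is_min_poly_def by auto
  have "map_poly of_rat (pderiv p) = (pderiv (map_poly of_rat p) :: real poly)"
    by (intro poly_eqI) (simp add: coeff_map_poly coeff_pderiv of_rat_mult of_rat_add)
  also have "\<dots> = [:-l, 1:] * pderiv s + s"
    using s by (simp add: p_def pderiv_mult pderiv_pCons del: mult_pCons_left)
  finally have "poly (map_poly of_rat (pderiv p)) l = 0" using \<open>poly s l = 0\<close> by simp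
  moreover have "pderiv p \<noteq> 0" using assms(2) by (simp add: p_def pderiv_eq_0_iff)
  ultimately have "degree p \<le> degree (pderiv p)" using p by blast
  thus False using assms(2) by (simp add: p_def degree_pderiv)
qed

text \<open>Since \<open>l\<close> is a simple root of its minimal polynomial, exactly one of \<open>\<plusminus>\<surd>l\<close> is a root of \<open>q\<close>, and
  it is a simple one. All other roots of \<open>q\<close> have a square that is a conjugate of \<open>l\<close> other than
  \<open>l\<close>, so they lie in the closed unit disc.\<close>

lemma square_root_poly_coeff_bound:
  fixes q :: "real poly"
  assumes l: "salem_number l" and m: "degree (min_poly l) = 2 * m" "m \<ge> 1"
    and q: "lead_coeff q = 1"
    and eq: "q * pcompose q [:0, -1:] = pcompose (map_poly of_rat (min_poly l)) [:0, 0, 1:]"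
  shows "degree q = 2 * m" "\<bar>coeff q i\<bar> \<le> 4 ^ m * sqrt l"
proof -
  define P :: "real poly" where "P = map_poly of_rat (min_poly l)"
  have "l > 1" "algebraic l" using l by (auto simp: salem_number_def)
  have "q \<noteq> 0" using q by auto
  have "degree (q * pcompose q [:0, -1:]) = 2 * degree q"
    using \<open>q \<noteq> 0\<close> by (subst degree_mult_eq) (auto simp: degree_pcompose pcompose_eq_0_iff)
  moreover have "degree (pcompose P [:0, 0, 1:]) = 4 * m"
    by (simp add: degree_pcompose P_def degree_map_poly m)
  ultimately show deg: "degree q = 2 * m" using eq by (simp add: P_def)
  have "poly P l = 0"
    using is_min_poly_min_poly[OF \<open>algebraic l\<close>] by (simp add: P_def is_min_poly_def)
  then obtain s where s: "P = [:-l, 1:] * s" by (auto simp: poly_eq_0_iff_dvd elim: dvdE)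
  have sl: "poly s l \<noteq> 0"
    using min_poly_simple_root[OF \<open>algebraic l\<close>] m s by (simp add: P_def)
  define \<sigma> where "\<sigma> = sqrt l"
  have \<sigma>: "\<sigma> ^ 2 = l" "\<sigma> \<ge> 1" using \<open>l > 1\<close> by (auto simp: \<sigma>_def)
  have "poly (q * pcompose q [:0, -1:]) \<sigma> = poly P (\<sigma> ^ 2)"
    by (simp add: eq poly_pcompose P_def power2_eq_square)
  hence "poly q \<sigma> * poly q (- \<sigma>) = 0" using \<sigma> \<open>poly P l = 0\<close> by (simp add: poly_pcompose)
  then obtain \<tau> where \<tau>: "poly q \<tau> = 0" "\<tau> = \<sigma> \<or> \<tau> = - \<sigma>" by auto
  hence \<tau>2: "\<tau> * \<tau> = l" "\<bar>\<tau>\<bar> = \<sigma>" using \<sigma> by (auto simp: power2_eq_square)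
  obtain t where t: "q = [:-\<tau>, 1:] * t" using \<tau>(1) by (auto simp: poly_eq_0_iff_dvd elim: dvdE)
  have "t \<noteq> 0" using t \<open>q \<noteq> 0\<close> by auto
  have degt: "degree t = 2 * m - 1"
    using deg \<open>t \<noteq> 0\<close> unfolding t by (subst (asm) degree_mult_eq) auto
  have lct: "lead_coeff t = 1" using q unfolding t by (subst (asm) lead_coeff_mult) simp
  have "[:-l, 0, 1:] * (- (t * pcompose t [:0, -1:])) = q * pcompose q [:0, -1:]"
  proof -
    have "[:-\<tau>, 1:] * pcompose [:-\<tau>, 1:] [:0, -1:] = - [:-l, 0, 1:]"
      by (simp add: pcompose_pCons \<tau>2(1))
    moreover have "q * pcompose q [:0, -1:] =
        ([:-\<tau>, 1:] * pcompose [:-\<tau>, 1:] [:0, -1:]) * (t * pcompose t [:0, -1:])"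
      unfolding t pcompose_mult by (simp only: mult_ac)
    ultimately show ?thesis by (simp only: minus_mult_left minus_mult_right)
  qed
  also have "\<dots> = [:-l, 0, 1:] * pcompose s [:0, 0, 1:]"
    unfolding eq P_def[symmetric] s pcompose_mult by (simp add: pcompose_pCons)
  finally have ts: "- (t * pcompose t [:0, -1:]) = pcompose s [:0, 0, 1:]"
    by (subst (asm) mult_cancel_left) auto
  \<comment> \<open>The cofactor \<open>t\<close> is viewed as a complex polynomial to bound its roots.\<close>
  define h where "h f = (map_poly of_real f :: complex poly)" for f
  have h_mult: "h (f * g) = h f * h g" for f g by (simp add: h_def map_poly_hom_mult)
  have h_comp: "poly (h (pcompose f g)) z = poly (h f) (poly (h g) z)" for f g z
  proof (induction f)
    case (pCons a f)
    have "h ([:a:] + u) = [:of_real a:] + h u" for u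
      by (intro poly_eqI) (simp add: h_def coeff_map_poly coeff_pCons split: nat.splits)
    thus ?case using pCons by (simp add: pcompose_pCons h_mult) (simp add: h_def map_poly_pCons)
  qed (simp add: h_def)
  have roots: "cmod z \<le> 1" if z: "poly (h t) z = 0" for z
  proof -
    have "h (- (t * pcompose t [:0, -1:])) = - (h t * h (pcompose t [:0, -1:]))"
      unfolding h_mult[symmetric] by (intro poly_eqI) (simp add: h_def coeff_map_poly)
    hence "poly (h (pcompose s [:0, 0, 1:])) z = 0" unfolding ts[symmetric] using z by simp
    hence sz: "poly (h s) (z ^ 2) = 0"
      unfolding h_comp by (simp add: h_def map_poly_pCons power2_eq_square)
    have "poly (h P) (z ^ 2) = 0" unfolding s h_mult using sz by simp
    hence "z ^ 2 \<in> rat_conjugates l"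
      by (simp add: rat_conjugates_def h_def P_def poly_map_poly_of_rat_real)
    moreover have "z ^ 2 \<noteq> of_real l"
      using sz sl by (auto simp: h_def poly_map_poly_of_real)
    ultimately have "cmod (z ^ 2) \<le> 1"
      using l \<open>l > 1\<close> unfolding salem_number_def
      by (cases "z ^ 2 = of_real (inverse l)") (auto simp: norm_inverse inverse_le_1_iff)
    thus ?thesis by (simp add: norm_power power_le_one_iff abs_square_le_1)
  qed
  have tb: "\<bar>coeff t j\<bar> \<le> 2 ^ (2 * m - 1)" for j
    using norm_coeff_le_of_roots_in_unit_disc[of "h t" j] roots lct degt
    by (simp add: h_def degree_map_poly coeff_map_poly)
  have "coeff q i = coeff (pCons 0 t) i - \<tau> * coeff t i" by (simp add: t)
  also have "\<bar>\<dots>\<bar> \<le> \<bar>coeff (pCons 0 t) i\<bar> + \<sigma> * \<bar>coeff t i\<bar>"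
    by (metis \<tau>2(2) abs_mult abs_triangle_ineq4)
  also have "\<dots> \<le> \<sigma> * 2 ^ (2 * m - 1) + \<sigma> * 2 ^ (2 * m - 1)"
  proof (intro add_mono mult_left_mono tb)
    have "\<bar>coeff (pCons 0 t) i\<bar> \<le> 1 * 2 ^ (2 * m - 1)"
      using tb by (auto simp: coeff_pCons split: nat.splits)
    also have "\<dots> \<le> \<sigma> * 2 ^ (2 * m - 1)" using \<sigma> by (intro mult_right_mono) auto
    finally show "\<bar>coeff (pCons 0 t) i\<bar> \<le> \<sigma> * 2 ^ (2 * m - 1)" .
  qed (use \<sigma> in auto)
  also have "\<dots> = \<sigma> * 2 ^ Suc (2 * m - 1)" by simp
  also have "Suc (2 * m - 1) = 2 * m" using m by simp
  finally show "\<bar>coeff q i\<bar> \<le> 4 ^ m * sqrt l" 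
    using power_mult[of "2::real" 2 m] by (simp add: \<sigma>_def mult.commute)
qed

section \<open>Integer parameters of the square root polynomial\<close>

text \<open>The unit in which the coefficient of degree \<open>i\<close> of \<open>q\<close> is measured: coefficients of even degree
  are integers, and those of odd degree are integer multiples of \<open>\<surd>n\<close>.\<close>

definition parity_weight :: "nat \<Rightarrow> nat \<Rightarrow> real" where
  "parity_weight n i = (if odd i then sqrt n else 1)"

text \<open>The number \<open>n\<close> and the integers \<open>b\<^sub>1, \<dots>, b\<^sub>m\<close> describe a palindromic square root polynomial of
  the minimal polynomial of \<open>l\<close>. The values of \<open>b\<close> outside \<open>{1..m}\<close> are irrelevant; the remaining
  coefficients of the polynomial are determined by its being monic and palindromic.\<close>

definition parametrizes :: "nat \<Rightarrow> nat \<Rightarrow> (nat \<Rightarrow> int) \<Rightarrow> real \<Rightarrow> bool" where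
  "parametrizes m n b l \<longleftrightarrow> (\<exists>q :: real poly.
     lead_coeff q = 1 \<and> palindromic q \<and> degree q = 2 * m \<and>
     (\<forall>i\<in>{1..m}. coeff q i = parity_weight n i * of_int (b i)) \<and>
     q * pcompose q [:0, -1:] = pcompose (map_poly of_rat (min_poly l)) [:0, 0, 1:])"

lemma palindromic_eqI:
  fixes q r :: "real poly"
  assumes "palindromic q" "palindromic r" "lead_coeff q = 1" "lead_coeff r = 1"
    and deg: "degree q = 2 * m" "degree r = 2 * m"
    and eq: "\<And>i. i \<in> {1..m} \<Longrightarrow> coeff q i = coeff r i"
  shows "q = r"
proof -
  have sym: "coeff f i = coeff f (degree f - i)" if "palindromic f" "i \<le> degree f" for f :: "real poly" and i
    using that unfolding palindromic_def by (metis coeff_reflect_poly not_less)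
  have low: "coeff q i = coeff r i" if "i \<le> m" for i
  proof (cases "i = 0")
    case True
    thus ?thesis using sym[of q 0] sym[of r 0] assms by simp
  qed (use that eq in auto)
  show ?thesis
  proof (intro poly_eqI)
    fix i
    show "coeff q i = coeff r i"
    proof (cases "i \<le> 2 * m")
      case True
      thus ?thesis using low[of i] low[of "2 * m - i"] sym[of q i] sym[of r i] assms deg
        by (cases "i \<le> m") auto
    qed (use deg in \<open>auto simp: coeff_eq_0\<close>)
  qed
qed

text \<open>The parameters determine \<open>q\<close>, hence the minimal polynomial and its roots, and a Salem number is
  the only conjugate of itself that is real and greater than 1.\<close>

lemma parametrizes_inj:
  assumes "salem_number l" "salem_number l'" "parametrizes m n b l" "parametrizes m n b l'"
  shows "l = l'"
proof -
  obtain q where q: "lead_coeff q = 1" "palindromic q" "degree q = 2 * m"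
     "\<And>i. i\<in>{1..m} \<Longrightarrow> coeff q i = parity_weight n i * of_int (b i)"
     "q * pcompose q [:0, -1:] = pcompose (map_poly of_rat (min_poly l)) [:0, 0, 1:]"
    using assms(3) unfolding parametrizes_def by blast
  obtain r where r: "lead_coeff r = 1" "palindromic r" "degree r = 2 * m"
     "\<And>i. i\<in>{1..m} \<Longrightarrow> coeff r i = parity_weight n i * of_int (b i)"
     "r * pcompose r [:0, -1:] = pcompose (map_poly of_rat (min_poly l')) [:0, 0, 1:]"
    using assms(4) unfolding parametrizes_def by blast
  have "q = r" by (rule palindromic_eqI) (use q r in auto)
  hence "pcompose (map_poly of_rat (min_poly l) - map_poly of_rat (min_poly l')) [:0, 0, 1:] = (0 :: real poly)"
    using q(5) r(5) by (simp add: pcompose_diff)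
  hence "map_poly of_rat (min_poly l) = (map_poly of_rat (min_poly l') :: real poly)"
    by (subst (asm) pcompose_eq_0_iff) auto
  hence "real_of_rat (coeff (min_poly l) i) = of_rat (coeff (min_poly l') i)" for i
    by (metis coeff_map_poly of_rat_0)
  hence "min_poly l = min_poly l'" by (intro poly_eqI) simp
  hence same: "rat_conjugates l = rat_conjugates l'" by (simp add: rat_conjugates_def)
  have "poly (map_poly of_rat (min_poly l)) l = 0"
    using is_min_poly_min_poly[of l] assms(1) by (auto simp: is_min_poly_def salem_number_def)
  hence "of_real l \<in> rat_conjugates l"
    unfolding rat_conjugates_def
    by (simp add: poly_map_poly_of_real flip: poly_map_poly_of_rat_real)
  hence "of_real l \<in> rat_conjugates l'" by (simp add: same)
  moreover have l: "l > 1" "l' > 1" using assms by (auto simp: salem_number_def)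
  moreover have "inverse l' < 1" using l by (simp add: inverse_less_1_iff)
  moreover have "cmod (of_real l) \<noteq> 1" using l by simp
  ultimately show ?thesis
    using assms(2) unfolding salem_number_def
    by (metis Diff_iff empty_iff insert_iff less_asym of_real_eq_iff)
qed

text \<open>For \<open>a = x / y\<close>, the number \<open>n\<close> is the squarefree part of \<open>x y = a y\<^sup>2\<close>.\<close>

lemma sqrt_rat_eq_sqrt_squarefree:
  fixes a :: rat
  assumes "a > 0"
  obtains n :: nat and c :: real where "squarefree n" "c \<in> \<rat>" "sqrt (of_rat a) = c * sqrt n"
proof -
  obtain x y where xy: "y > 0" "a = of_int x / of_int y"
    by (cases a) (auto simp: Fract_of_int_quotient)
  have "x > 0" using assms xy by (simp add: zero_less_divide_iff)
  define N where "N = nat x * nat y"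
  define n where "n = squarefree_part N"
  define f where "f = square_part N"
  have N: "N = n * f ^ 2" unfolding n_def f_def by (rule squarefree_decompose)
  have "real_of_rat a = real N / of_int y ^ 2"
    using xy \<open>x > 0\<close> by (simp add: N_def of_rat_divide power2_eq_square)
  also have "sqrt \<dots> = (real f / of_int y) * sqrt n"
    using xy by (simp add: N real_sqrt_divide real_sqrt_mult)
  finally have "sqrt (of_rat a) = (real f / of_int y) * sqrt n" .
  moreover have "real f / of_int y \<in> \<rat>" by auto
  moreover have "squarefree n" unfolding n_def by (rule squarefree_squarefree_part) 
  ultimately show thesis using that by blast
qed

text \<open>The bound on \<open>n\<close> holds because a nonzero coefficient of odd degree has absolute value at least
  \<open>\<surd>n\<close>.\<close>

lemma Sal_sq_parametrized:
  assumes "m \<ge> 1" "l \<in> Sal_sq m Q"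
  obtains n b where "parametrizes m n b l" "n \<ge> 1" "real n \<le> (4 ^ m * sqrt Q) ^ 2"
    "\<And>i. parity_weight n i * \<bar>of_int (b i)\<bar> \<le> 4 ^ m * sqrt Q"
proof -
  have l: "salem_number l" "degree (min_poly l) = 2 * m" "square_rootable l" "1 < l" "l \<le> Q"
    using assms(2) by (auto simp: Sal_sq_def)
  obtain a :: rat and q :: "real poly" where a: "a > 0" and q: "lead_coeff q = 1" "palindromic q"
      "\<And>i. even i \<Longrightarrow> coeff q i \<in> \<rat>" "\<And>i. odd i \<Longrightarrow> \<exists>r\<in>\<rat>. coeff q i = sqrt (of_rat a) * r"
      and eq: "q * pcompose q [:0, -1:] = pcompose (map_poly of_rat (min_poly l)) [:0, 0, 1:]"
    using l(3) unfolding square_rootable_def by blast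
  define B where "B = 4 ^ m * sqrt Q"
  have deg: "degree q = 2 * m"
    using square_root_poly_coeff_bound(1)[OF l(1,2) assms(1) q(1) eq] .
  have bound: "\<bar>coeff q i\<bar> \<le> B" for i
  proof -
    have "\<bar>coeff q i\<bar> \<le> 4 ^ m * sqrt l"
      using square_root_poly_coeff_bound(2)[OF l(1,2) assms(1) q(1) eq] .
    also have "\<dots> \<le> B" using l by (simp add: B_def)
    finally show ?thesis .
  qed
  have "B \<ge> 1 * 1" unfolding B_def using l by (intro mult_mono) auto
  \<comment> \<open>For two odd indices, the factor \<open>(\<surd>a)\<^sup>2 = a\<close> is rational.\<close>
  have "coeff q i * coeff q j \<in> \<rat>" if "even (i + j)" for i j
  proof (cases "even i")
    case True
    thus ?thesis using that q(3) by auto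
  next
    case False
    hence "odd j" using that by simp
    obtain r r' where "r \<in> \<rat>" "r' \<in> \<rat>" "coeff q i = sqrt (of_rat a) * r" "coeff q j = sqrt (of_rat a) * r'"
      using q(4)[OF False] q(4)[OF \<open>odd j\<close>] by blast
    moreover from this have "coeff q i * coeff q j = (sqrt (of_rat a) * sqrt (of_rat a)) * (r * r')"
      by (simp only: mult_ac)
    moreover have "sqrt (of_rat a) * sqrt (of_rat a) = real_of_rat a" using a by simp
    ultimately show ?thesis by (metis Rats_mult Rats_of_rat)
  qed
  moreover have "coeff (q * pcompose q [:0, -1:]) (2 * i) \<in> \<int>" for i
  proof -
    have c: "coeff (pcompose f [:0, 0, 1:]) (2 * i) = coeff f i" for f :: "real poly" and i
    proof (induction f arbitrary: i)
      case (pCons a f)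
      show ?case using pCons.IH by (cases i) (simp_all add: pcompose_pCons)
    qed simp
    have "coeff (min_poly l) i \<in> \<int>"
      using l(1) by (intro coeff_min_poly_in_Ints) (auto simp: salem_number_def)
    thus ?thesis unfolding eq c by (auto simp: coeff_map_poly elim!: Ints_cases)
  qed
  ultimately have sq: "coeff q i ^ 2 \<in> \<int>" for i by (rule coeff_square_integral)
  have ev: "coeff q i \<in> \<int>" if "even i" for i
    using squarefree_mult_square_integral[of 1 "coeff q i"] sq[of i] q(3)[OF that] by simp
  obtain n :: nat and c where n: "squarefree n" "c \<in> \<rat>" "sqrt (of_rat a) = c * sqrt n"
    by (rule sqrt_rat_eq_sqrt_squarefree[OF a])
  have od: "\<exists>k::int. coeff q i = sqrt n * of_int k" if i: "odd i" for i
  proof -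
    obtain r where "r \<in> \<rat>" "coeff q i = sqrt (of_rat a) * r"
      using q(4)[OF i] by blast
    hence r: "r \<in> \<rat>" "coeff q i = sqrt n * (c * r)"
      by (simp_all only: n(3) mult_ac)
    have "of_nat n * (c * r) ^ 2 \<in> \<int>" using sq[of i] by (simp add: r(2) power_mult_distrib)
    hence "c * r \<in> \<int>" by (rule squarefree_mult_square_integral[OF n(1) Rats_mult[OF n(2) r(1)]])
    thus ?thesis using r(2) by (auto elim: Ints_cases)
  qed
  have "\<exists>b. \<forall>i. coeff q i = parity_weight n i * of_int (b i)"
  proof (intro choice allI)
    show "\<exists>k. coeff q i = parity_weight n i * of_int k" for i
      using ev[of i] od[of i] by (auto simp: parity_weight_def elim: Ints_cases)
  qed
  then obtain b where b: "\<And>i. coeff q i = parity_weight n i * of_int (b i)" by blast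
  have "\<exists>n b. n \<ge> 1 \<and> real n \<le> B ^ 2 \<and> (\<forall>i. coeff q i = parity_weight n i * of_int (b i))"
  proof (cases "\<exists>i. odd i \<and> coeff q i \<noteq> 0")
    case True
    then obtain i where i: "odd i" "coeff q i \<noteq> 0" by blast
    hence "b i \<noteq> 0" using b[of i] by auto
    have "sqrt n * 1 \<le> sqrt n * \<bar>of_int (b i)\<bar>" using \<open>b i \<noteq> 0\<close> by (intro mult_left_mono) auto
    also have "\<dots> \<le> B" using bound[of i] b[of i] i by (simp add: parity_weight_def abs_mult)
    finally have "sqrt n ^ 2 \<le> B ^ 2" by (intro power_mono) auto
    moreover have "n \<noteq> 0" using n(1) by (rule contrapos_pn) simp
    ultimately show ?thesis using b by (intro exI[of _ n] exI[of _ b]) auto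
  next
    case False
    \<comment> \<open>All coefficients of odd degree vanish, so \<open>n\<close> is arbitrary and \<open>n = 1\<close> is in range.\<close>
    define b' where "b' i = (if odd i then 0 else b i)" for i
    have "coeff q i = parity_weight 1 i * of_int (b' i)" for i
      using False b[of i] by (auto simp: b'_def parity_weight_def)
    thus ?thesis using \<open>B \<ge> 1 * 1\<close> by (intro exI[of _ 1] exI[of _ b']) auto
  qed
  then obtain n b where nb: "n \<ge> 1" "real n \<le> B ^ 2" "\<And>i. coeff q i = parity_weight n i * of_int (b i)"
    by blast
  show thesis
  proof (rule that)
    show "parametrizes m n b l"
      unfolding parametrizes_def using q deg nb(3) eq by blast
    show "parity_weight n i * \<bar>of_int (b i)\<bar> \<le> 4 ^ m * sqrt Q" for i
      using bound[of i] nb(3)[of i] by (simp add: parity_weight_def abs_mult B_def split: if_splits)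
  qed (use nb in \<open>auto simp: B_def\<close>)
qed

section \<open>Counting the parameters\<close>

lemma card_int_abs_le:
  fixes x :: real
  assumes "x \<ge> 1"
  shows "finite {b::int. \<bar>of_int b\<bar> \<le> x}" "real (card {b::int. \<bar>of_int b\<bar> \<le> x}) \<le> 3 * x"
proof -
  have eq: "{b::int. \<bar>of_int b\<bar> \<le> x} = {-\<lfloor>x\<rfloor>..\<lfloor>x\<rfloor>}"
    by (auto simp: le_floor_iff abs_le_iff) linarith+
  show "finite {b::int. \<bar>of_int b\<bar> \<le> x}" by (simp add: eq)
  have "real (card {b::int. \<bar>of_int b\<bar> \<le> x}) = 2 * of_int \<lfloor>x\<rfloor> + 1"
    using assms by (simp add: eq)
  also have "\<dots> \<le> 3 * x" using assms by linarith
  finally show "real (card {b::int. \<bar>of_int b\<bar> \<le> x}) \<le> 3 * x" .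
qed

text \<open>There are \<open>\<lceil>m / 2\<rceil>\<close> odd numbers in \<open>{1..m}\<close>.\<close>

lemma prod_parity_weight: "(\<Prod>i=1..m. parity_weight n i) = sqrt n ^ ((m + 1) div 2)"
proof (induction m)
  case (Suc m)
  consider k where "m = 2 * k" | k where "m = 2 * k + 1" by (metis oddE evenE)
  thus ?case using Suc by cases (simp_all add: parity_weight_def)
qed simp

text \<open>For fixed \<open>n\<close>, the coefficient of degree \<open>i\<close> has at most \<open>3 B / w\<close> possible values, where \<open>w\<close> is its
  weight. Since \<open>n \<le> B\<^sup>2\<close>, the ratio \<open>B / w\<close> is at least 1, which absorbs the additive constant.\<close>

lemma card_Sal_sq_le:
  assumes "m \<ge> 1" "Q > 1"
  defines "B \<equiv> 4 ^ m * sqrt Q"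
  shows "finite (Sal_sq m Q)"
    and "real (card (Sal_sq m Q)) \<le>
           (3 * B) ^ m * (\<Sum>n=1..nat \<lfloor>B ^ 2\<rfloor>. 1 / sqrt n ^ ((m + 1) div 2))"
proof -
  have "B > 0" using assms by (simp add: B_def)
  define N where "N = nat \<lfloor>B ^ 2\<rfloor>"
  define X where "X n i = {b::int. \<bar>of_int b\<bar> \<le> B / parity_weight n i}" for n i
  define box where "box n = (\<Pi>\<^sub>E i\<in>{1..m}. X n i)" for n
  define S where "S = Sigma {1..N} box"
  have w: "parity_weight n i > 0" "B / parity_weight n i \<ge> 1" if "n \<in> {1..N}" for n i
  proof -
    have n: "n \<ge> 1" "real n \<le> B ^ 2" using that by (auto simp: N_def le_nat_iff le_floor_iff)
    show "parity_weight n i > 0" using n by (simp add: parity_weight_def)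
    have "sqrt n \<le> sqrt (B ^ 2)" using n by (simp only: real_sqrt_le_iff)
    hence "sqrt n \<le> B" using \<open>B > 0\<close> by simp
    moreover have "1 \<le> sqrt n" using n by simp
    ultimately show "B / parity_weight n i \<ge> 1"
      using order_trans[of 1 "sqrt n" B] n by (auto simp: parity_weight_def le_divide_eq)
  qed
  have fin_box: "finite (box n)" if "n \<in> {1..N}" for n
    unfolding box_def X_def by (intro finite_PiE card_int_abs_le w that) auto
  hence fin: "finite S" unfolding S_def by (intro finite_SigmaI) auto
  have card_box: "real (card (box n)) \<le> (3 * B) ^ m * (1 / sqrt n ^ ((m + 1) div 2))"
    if n: "n \<in> {1..N}" for n
  proof -
    have "real (card (box n)) = (\<Prod>i=1..m. real (card (X n i)))"
      by (simp add: box_def card_PiE)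
    also have "\<dots> \<le> (\<Prod>i=1..m. 3 * (B / parity_weight n i))"
      unfolding X_def by (intro prod_mono conjI card_int_abs_le w n) auto
    also have "\<dots> = (\<Prod>i=1..m. 3 * B) / (\<Prod>i=1..m. parity_weight n i)"
      by (simp only: times_divide_eq_right prod_dividef)
    finally show ?thesis by (simp only: prod_parity_weight) simp
  qed
  \<comment> \<open>The Salem number with given parameters; unspecified if there is none.\<close>
  define \<phi> where "\<phi> = (\<lambda>(n, b). THE l. salem_number l \<and> parametrizes m n b l)"
  have sub: "Sal_sq m Q \<subseteq> \<phi> ` S"
  proof
    fix l assume l: "l \<in> Sal_sq m Q"
    then obtain n b where nb: "parametrizes m n b l" "n \<ge> 1" "real n \<le> B ^ 2"
        "\<And>i. parity_weight n i * \<bar>of_int (b i)\<bar> \<le> B"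
      unfolding B_def using Sal_sq_parametrized[OF assms(1) l] by blast
    define b' where "b' = restrict b {1..m}"
    have "n \<in> {1..N}" using nb by (auto simp: N_def le_nat_iff le_floor_iff)
    moreover have "b' \<in> box n"
      unfolding box_def X_def b'_def using nb(4) w(1)[OF \<open>n \<in> {1..N}\<close>]
      by (auto simp: le_divide_eq mult.commute)
    ultimately have "(n, b') \<in> S" by (simp add: S_def)
    moreover have "parametrizes m n b' l" using nb(1) by (simp add: parametrizes_def b'_def)
    moreover have "salem_number l" using l by (simp add: Sal_sq_def)
    ultimately have "\<phi> (n, b') = l"
      unfolding \<phi>_def using parametrizes_inj by (auto intro!: the_equality)
    thus "l \<in> \<phi> ` S" using \<open>(n, b') \<in> S\<close> by force
  qed
  show "finite (Sal_sq m Q)" using finite_subset[OF sub] fin by blast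
  have "card (Sal_sq m Q) \<le> card S"
    using card_mono[OF _ sub] card_image_le[OF fin, of \<phi>] fin by force
  hence "real (card (Sal_sq m Q)) \<le> real (card S)" by simp
  also have "\<dots> = (\<Sum>n=1..N. real (card (box n)))"
    unfolding S_def using fin_box by simp
  also have "\<dots> \<le> (\<Sum>n=1..N. (3 * B) ^ m * (1 / sqrt n ^ ((m + 1) div 2)))"
    by (intro sum_mono card_box)
  finally show "real (card (Sal_sq m Q)) \<le>
      (3 * B) ^ m * (\<Sum>n=1..nat \<lfloor>B ^ 2\<rfloor>. 1 / sqrt n ^ ((m + 1) div 2))"
    by (simp only: N_def sum_distrib_left)
qed

section \<open>Sums of powers of inverse square roots\<close>

lemma sum_inverse_sqrt_le: "(\<Sum>n=1..N::nat. 1 / sqrt n) \<le> 2 * sqrt N"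
proof (induction N)
  case (Suc N)
  define x y where "x = sqrt N" and "y = sqrt (Suc N)"
  have xy: "x \<ge> 0" "y > 0" "y ^ 2 = x ^ 2 + 1" by (auto simp: x_def y_def)
  have "2 * x * y \<le> x ^ 2 + y ^ 2" using sum_squares_bound[of x y] by simp
  hence "1 \<le> (2 * (y - x)) * y" using xy(3) by (simp add: algebra_simps power2_eq_square)
  hence "1 / y \<le> 2 * (y - x)" using xy(2) by (simp add: divide_le_eq)
  thus ?case using Suc by (simp add: x_def y_def)
qed simp

lemma sum_inverse_le_ln: "N \<ge> 1 \<Longrightarrow> (\<Sum>n=1..N::nat. 1 / real n) \<le> 1 + ln N"
proof (induction N rule: dec_induct)
  case (step N)
  have "ln (real N / real (Suc N)) \<le> real N / real (Suc N) - 1"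
    using step by (intro ln_le_minus_one) auto
  also have "\<dots> = - (1 / real (Suc N))" by (simp add: field_simps)
  finally have "1 / real (Suc N) \<le> ln (Suc N) - ln N"
    using step by (simp add: ln_div)
  thus ?case using step by simp
qed simp

lemma sum_inverse_sqrt_cubed_le: "N \<ge> 1 \<Longrightarrow> (\<Sum>n=1..N::nat. 1 / sqrt n ^ 3) \<le> 3 - 2 / sqrt N"
proof (induction N rule: dec_induct)
  case (step N)
  define x y where "x = sqrt N" and "y = sqrt (Suc N)"
  have xy: "x > 0" "y > 0" "y ^ 2 = x ^ 2 + 1" "x \<le> y" using step by (auto simp: x_def y_def)
  have d: "(y - x) * (y + x) = 1" using xy(3) by (simp add: algebra_simps power2_eq_square)
  have "x * (y + x) \<le> y * (y + y)" using xy by (intro mult_mono) auto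
  hence "x * (y + x) * (y - x) \<le> 2 * y ^ 2 * (y - x)"
    using xy by (intro mult_right_mono) (auto simp: power2_eq_square)
  hence "x \<le> 2 * y ^ 2 * (y - x)" using d by (simp add: mult_ac)
  hence "x / (x * y ^ 3) \<le> 2 * y ^ 2 * (y - x) / (x * y ^ 3)"
    using xy by (intro divide_right_mono) auto
  also have "\<dots> = 2 / x - 2 / y"
    using xy(1,2) by (simp add: divide_simps power2_eq_square power3_eq_cube)
  finally have "1 / y ^ 3 \<le> 2 / x - 2 / y" using xy(1) by simp
  thus ?case using step by (simp add: x_def y_def)
qed simp

lemma sum_inverse_sqrt_power_le:
  assumes "k \<ge> 3"
  shows "(\<Sum>n=1..N::nat. 1 / sqrt n ^ k) \<le> 3"
proof (cases "N = 0")
  case False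
  have "(\<Sum>n=1..N::nat. 1 / sqrt n ^ k) \<le> (\<Sum>n=1..N::nat. 1 / sqrt n ^ 3)"
    using assms by (intro sum_mono divide_left_mono power_increasing) auto
  also have "\<dots> \<le> 3 - 2 / sqrt N" using False by (intro sum_inverse_sqrt_cubed_le) auto
  also have "\<dots> \<le> 3" by simp
  finally show ?thesis .
qed simp

text \<open>The exponent \<open>\<lceil>m / 2\<rceil>\<close> is 1 for \<open>m = 1, 2\<close>, it is 2 for \<open>m = 3, 4\<close>, and it is at least 3 for
  \<open>m \<ge> 5\<close>: the sum over \<open>n\<close> grows like a square root, like a logarithm, or converges. Requiring
  \<open>Q \<ge> e\<close> makes \<open>ln Q \<ge> 1\<close>, so that constants are absorbed by the logarithm.\<close>

lemma sum_le_eta: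
  assumes "m \<ge> 1" "C \<ge> 1"
  obtains K where
    "\<And>Q. Q \<ge> exp 1 \<Longrightarrow>
       (\<Sum>n=1..nat \<lfloor>(C * sqrt Q) ^ 2\<rfloor>. 1 / sqrt n ^ ((m + 1) div 2)) \<le> K * eta Q m"
proof -
  define K where "K = max (2 * C) (max (2 + 2 * ln C) 3)"
  have "(\<Sum>n=1..nat \<lfloor>(C * sqrt Q) ^ 2\<rfloor>. 1 / sqrt n ^ ((m + 1) div 2)) \<le> K * eta Q m"
    if Q: "Q \<ge> exp 1" for Q
  proof -
    define N where "N = nat \<lfloor>(C * sqrt Q) ^ 2\<rfloor>"
    have "exp 1 \<ge> (1::real)" by simp
    hence "Q \<ge> 1" using Q by linarith
    have N: "real N \<le> (C * sqrt Q) ^ 2" unfolding N_def by simp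
    have "1 * 1 \<le> C * sqrt Q" using assms \<open>Q \<ge> 1\<close> by (intro mult_mono) auto
    hence "1 \<le> (C * sqrt Q) ^ 2" by (intro one_le_power) simp
    hence "N \<ge> 1" unfolding N_def by (simp add: le_nat_iff le_floor_iff)
    have lnQ: "ln Q \<ge> 1" using Q \<open>Q \<ge> 1\<close> by (simp add: ln_ge_iff)
    consider "m = 1 \<or> m = 2" | "m = 3 \<or> m = 4" | "m \<ge> 5" using assms(1) by linarith
    hence "(\<Sum>n=1..N. 1 / sqrt n ^ ((m + 1) div 2)) \<le> K * eta Q m"
    proof cases
      case 1
      hence k: "(m + 1) div 2 = 1" by auto
      have "(\<Sum>n=1..N::nat. 1 / sqrt n ^ ((m + 1) div 2)) \<le> 2 * sqrt N"
        unfolding k using sum_inverse_sqrt_le[of N] by simp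
      also have "sqrt N \<le> sqrt ((C * sqrt Q) ^ 2)" using N by (simp only: real_sqrt_le_iff)
      also have "\<dots> = C * sqrt Q" using assms \<open>Q \<ge> 1\<close> by simp
      also have "2 * (C * sqrt Q) = 2 * C * eta Q m"
        using 1 \<open>Q \<ge> 1\<close> by (auto simp: eta_def powr_half_sqrt)
      also have "\<dots> \<le> K * eta Q m" using 1 by (intro mult_right_mono) (auto simp: K_def eta_def)
      finally show ?thesis by simp
    next
      case 2
      hence k: "(m + 1) div 2 = 2" by auto
      have "(\<Sum>n=1..N::nat. 1 / sqrt n ^ ((m + 1) div 2)) \<le> 1 + ln N"
        unfolding k using sum_inverse_le_ln[OF \<open>N \<ge> 1\<close>] by simp
      also have "ln N \<le> ln ((C * sqrt Q) ^ 2)" using N \<open>N \<ge> 1\<close> by (subst ln_le_cancel_iff) auto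
      also have "\<dots> = 2 * ln C + ln Q"
        using assms \<open>Q \<ge> 1\<close> by (simp add: ln_mult ln_sqrt ln_realpow)
      also have "1 + (2 * ln C + ln Q) \<le> (2 + 2 * ln C) * ln Q"
      proof -
        have "2 * ln C * 1 \<le> 2 * ln C * ln Q" using assms lnQ by (intro mult_left_mono) auto
        thus ?thesis using lnQ by (simp add: algebra_simps)
      qed
      also have "\<dots> \<le> K * ln Q" using lnQ by (intro mult_right_mono) (auto simp: K_def)
      finally show ?thesis using 2 by (auto simp: eta_def)
    next
      case 3
      have "(\<Sum>n=1..N::nat. 1 / sqrt n ^ ((m + 1) div 2)) \<le> 3"
        using 3 by (intro sum_inverse_sqrt_power_le) auto
      also have "3 \<le> K" by (simp add: K_def)
      finally show ?thesis using 3 by (simp add: eta_def)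
    qed
    thus ?thesis by (simp only: N_def)
  qed
  thus thesis by (rule that)
qed

section \<open>The number of square-rootable Salem numbers\<close>

theorem proposition1p6:
  fixes m :: nat
  assumes "m \<ge> 1"
  shows "(\<forall>Q>1. finite (Sal_sq m Q)) \<and>
    (\<lambda>Q. real (card (Sal_sq m Q))) \<in> O[at_top](\<lambda>Q. Q powr (real m / 2) * eta Q m)"
proof
  show "\<forall>Q>1. finite (Sal_sq m Q)" using card_Sal_sq_le(1)[OF assms] by blast
  define C :: real where "C = 4 ^ m"
  have "C \<ge> 1" by (simp add: C_def)
  obtain K where K: "\<And>Q. Q \<ge> exp 1 \<Longrightarrow>
       (\<Sum>n=1..nat \<lfloor>(C * sqrt Q) ^ 2\<rfloor>. 1 / sqrt n ^ ((m + 1) div 2)) \<le> K * eta Q m"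
    using sum_le_eta[OF assms \<open>C \<ge> 1\<close>] by blast
  have "real (card (Sal_sq m Q)) \<le> ((3 * C) ^ m * K) * (Q powr (real m / 2) * eta Q m)"
    if Q: "Q \<ge> exp 1" for Q
  proof -
    have "exp 1 > (1::real)" by simp
    hence "Q > 1" using Q by linarith
    have pw: "sqrt Q ^ m = Q powr (real m / 2)"
      using \<open>Q > 1\<close> by (simp add: powr_powr flip: powr_half_sqrt powr_realpow)
    have "real (card (Sal_sq m Q)) \<le> (3 * (C * sqrt Q)) ^ m *
        (\<Sum>n=1..nat \<lfloor>(C * sqrt Q) ^ 2\<rfloor>. 1 / sqrt n ^ ((m + 1) div 2))"
      unfolding C_def by (rule card_Sal_sq_le(2)[OF assms \<open>Q > 1\<close>])
    also have "\<dots> \<le> (3 * (C * sqrt Q)) ^ m * (K * eta Q m)"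
      using K[OF Q] \<open>Q > 1\<close> \<open>C \<ge> 1\<close> by (intro mult_left_mono) auto
    also have "\<dots> = ((3 * C) ^ m * K) * (Q powr (real m / 2) * eta Q m)"
      by (simp add: power_mult_distrib pw mult_ac)
    finally show ?thesis .
  qed
  hence "norm (real (card (Sal_sq m Q))) \<le>
      \<bar>(3 * C) ^ m * K\<bar> * norm (Q powr (real m / 2) * eta Q m)" if "Q \<ge> exp 1" for Q
    using order_trans[OF _ abs_ge_self] that by (fastforce simp: abs_mult)
  hence "eventually (\<lambda>Q. norm (real (card (Sal_sq m Q))) \<le>
      \<bar>(3 * C) ^ m * K\<bar> * norm (Q powr (real m / 2) * eta Q m)) at_top"
    by (auto simp: eventually_at_top_linorder)
  thus "(\<lambda>Q. real (card (Sal_sq m Q))) \<in> O[at_top](\<lambda>Q. Q powr (real m / 2) * eta Q m)"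
    by (rule bigoI)
qed

end
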